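(* Let $G$ be a graph, let $e=(u,v)$ be an edge of $G$, and let $G^*$ be the graph obtained from $G$ by subdividing $e$ with a new vertex $w$. Then $$\left\lceil \frac{mp(G)+1}{2}\right\rceil \leq mp(G^* ) \leq mp(G)+1,$$ and both bounds are sharp, that is, for each of the two inequalities there exist a graph $G$ and an edge $e$ of $G$ for which equality holds.
   Context: All graphs are finite, simple, undirected, with non-empty vertex set. A path $v_1v_2\ldots v_k$ (distinct vertices, consecutive ones adjacent, $k\ge 1$) in a graph $G$ is degree monotone if $\deg(v_1)\le \deg(v_2)\le\dots\le\deg(v_k)$ or $\deg(v_1)\ge\deg(v_2)\ge\dots\ge\deg(v_k)$, where degrees are taken in $G$. The length of a degree monotone path is its number of vertices, and $mp(G)$ is the maximum length of a degree monotone path in $G$. Subdividing an edge $e=(u,v)$ means deleting the edge $(u,v)$, adding a new vertex $w$, and adding the edges $(u,w)$ and $(w,v)$. *)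

theory Defs
  imports "Graph_Theory.Pair_Digraph" "Graph_Theory.Vertex_Walk"
begin

text \<open>
  Finite simple undirected graphs are \<^locale>\<open>pair_graph\<close>s: finite, loop-free, symmetric sets of
  vertex pairs. An undirected edge is stored as two opposite arcs, so the out-degree is the
  degree in the undirected graph, and \<^const>\<open>subdivide\<close> removes and adds the arcs of both
  directions. The library locale admits the empty graph, which is excluded here.
\<close>

definition nonempty_graph :: "'a pair_pre_digraph \<Rightarrow> bool" where
  "nonempty_graph G \<longleftrightarrow> pair_graph G \<and> pverts G \<noteq> {}"

abbreviation deg :: "'a pair_pre_digraph \<Rightarrow> 'a \<Rightarrow> nat" where
  "deg G v \<equiv> out_degree (with_proj G) v"

definition degree_monotone_path :: "'a pair_pre_digraph \<Rightarrow> 'a list \<Rightarrow> bool" where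
  "degree_monotone_path G p \<longleftrightarrow> vpath p (with_proj G) \<and>
     (sorted_wrt (\<le>) (map (deg G) p) \<or> sorted_wrt (\<ge>) (map (deg G) p))"

text \<open>The length of a degree monotone path is its number of vertices, i.e. the list length
  (not \<^const>\<open>vwalk_length\<close>, which counts arcs).\<close>

definition mp :: "'a pair_pre_digraph \<Rightarrow> nat" where
  "mp G = Max {length p | p. degree_monotone_path G p}"

text \<open>The maximum is taken over a finite non-empty set.\<close>

lemma
  assumes "nonempty_graph G"
  shows finite_degree_monotone_lengths: "finite {length p | p. degree_monotone_path G p}"
    and degree_monotone_lengths_nonempty: "{length p | p. degree_monotone_path G p} \<noteq> {}"
proof -
  interpret pair_graph G using assms by (simp add: nonempty_graph_def)
  have "length p \<le> card (pverts G)" if "degree_monotone_path G p" for p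
  proof -
    have "set p \<subseteq> pverts G" "distinct p"
      using that by (auto simp: degree_monotone_path_def vpath_def vwalk_def)
    then show ?thesis
      using card_mono[OF pair_finite_verts] distinct_card by metis
  qed
  then show "finite {length p | p. degree_monotone_path G p}"
    by (intro finite_subset[OF _ finite_atMost[of "card (pverts G)"]]) auto
  obtain x where "x \<in> pverts G" using assms by (auto simp: nonempty_graph_def)
  then have "degree_monotone_path G [x]"
    by (auto simp: degree_monotone_path_def vpath_def vwalk_def)
  then show "{length p | p. degree_monotone_path G p} \<noteq> {}" by blast
qed

end

theory Submission
  imports Defs
begin

text \<open>
  Subdivision keeps all old degrees and gives the new vertex \<open>w\<close> degree 2. Deleting \<open>w\<close> from a
  degree monotone path of the subdivided graph leaves one of the original graph, which is the upper
  bound. For the lower bound, a longest ascending path \<open>A @ B\<close> through the subdivided edge breaks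
  into \<open>A\<close> and \<open>B\<close>, and one of them can be prolonged by \<open>w\<close>: \<open>B\<close> at its front if its first vertex
  has degree at least 2, and \<open>A\<close> at its end otherwise. So the two pieces together have at least
  \<open>mp G + 1\<close> vertices, and the longer one at least half of them.
  Subdividing an edge of a triangle attains the upper bound, subdividing a single edge the lower one.
\<close>

section \<open>Degree monotone paths as lists, and basic facts on \<open>mp\<close>\<close>

lemma set_vwalk_arcs_subset_iff:
  "set (vwalk_arcs p) \<subseteq> R \<longleftrightarrow> successively (\<lambda>x y. (x, y) \<in> R) p"
  by (induction p rule: vwalk_arcs.induct) auto

text \<open>With \<open>successively\<close> in place of \<open>vwalk_arcs\<close>, the append and
  Cons rules for lists apply directly when paths are cut and extended.\<close>

lemma degree_monotone_path_iff:
  "degree_monotone_path G p \<longleftrightarrow>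
     p \<noteq> [] \<and> set p \<subseteq> pverts G \<and> distinct p \<and> successively (\<lambda>x y. (x, y) \<in> parcs G) p \<and>
     (sorted_wrt (\<le>) (map (deg G) p) \<or> sorted_wrt (\<ge>) (map (deg G) p))"
  unfolding degree_monotone_path_def vpath_def vwalk_def
  by (auto simp: set_vwalk_arcs_subset_iff)

text \<open>Arcs are symmetric, and reversal exchanges ascending and descending degrees. Hence a
  longest path may be taken ascending.\<close>

lemma degree_monotone_path_rev:
  assumes "pair_graph G" "degree_monotone_path G p"
  shows "degree_monotone_path G (rev p)"
proof -
  interpret pair_graph G by fact
  have "successively (\<lambda>x y. (y, x) \<in> parcs G) p"
    using assms(2) by (auto simp: degree_monotone_path_iff
        intro: arcs_symmetric elim!: successively_mono)
  then show ?thesis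
    using assms(2) by (auto simp: degree_monotone_path_iff rev_map[symmetric] sorted_wrt_rev)
qed

lemma length_le_mp:
  assumes "nonempty_graph G" "degree_monotone_path G p"
  shows "length p \<le> mp G"
  unfolding mp_def using assms finite_degree_monotone_lengths by (intro Max_ge) auto

lemma mp_attained:
  assumes "nonempty_graph G"
  obtains p where "degree_monotone_path G p" "length p = mp G"
  using Max_in[OF finite_degree_monotone_lengths[OF assms] degree_monotone_lengths_nonempty[OF assms]]
  unfolding mp_def[symmetric] by auto

lemma mp_le:
  assumes "nonempty_graph G" "\<And>p. degree_monotone_path G p \<Longrightarrow> length p \<le> n"
  shows "mp G \<le> n"
  using mp_attained[OF assms(1)] assms(2) by metis

lemma mp_le_card:
  assumes "nonempty_graph G"
  shows "mp G \<le> card (pverts G)"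
proof (rule mp_le[OF assms])
  fix p assume "degree_monotone_path G p"
  moreover have "finite (pverts G)"
    using assms by (auto simp: nonempty_graph_def intro: pair_fin_digraph.pair_finite_verts
        pair_graph.axioms pair_digraph.axioms)
  ultimately show "length p \<le> card (pverts G)"
    by (metis card_mono degree_monotone_path_iff distinct_card)
qed

lemma mp_pos:
  assumes "nonempty_graph G"
  shows "mp G > 0"
  using mp_attained[OF assms] by (metis degree_monotone_path_iff length_greater_0_conv)

section \<open>The subdivided graph and its degrees\<close>

lemma subdivide_swap: "subdivide G (v, u) w = subdivide G (u, v) w"
  by (auto simp: subdivide.simps)

text \<open>\<open>H\<close> is a parameter fixed by an equation, so that exchanging
  \<open>u\<close> and \<open>v\<close> yields an instance of the locale with the same
  \<open>H\<close>. By \<open>swap\<close>, facts proved for one end or one direction of the edge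
  carry over to the other.\<close>

locale edge_subdivision = pair_graph G for G :: "'a pair_pre_digraph" +
  fixes u v w :: 'a and H :: "'a pair_pre_digraph"
  assumes edge: "(u, v) \<in> parcs G"
    and new: "w \<notin> pverts G"
    and H_eq: "H = subdivide G (u, v) w"
begin

lemma edge': "(v, u) \<in> parcs G"
  using edge by (rule arcs_symmetric)

lemma ends: "u \<in> pverts G" "v \<in> pverts G" "u \<noteq> v" "u \<noteq> w" "v \<noteq> w"
  using edge new by (auto dest: in_arcsD1 in_arcsD2 pair_no_loops)

lemma verts_H: "pverts H = insert w (pverts G)"
  by (simp add: H_eq)

lemma new_arcs: "(w, x) \<notin> parcs G" "(x, w) \<notin> parcs G"
  using new by (auto dest: in_arcsD1 in_arcsD2)

lemma swap: "edge_subdivision G v u w H"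
  by unfold_locales (simp_all add: edge' new H_eq subdivide_swap)

lemma nonempty: "nonempty_graph G"
  using ends pair_graph by (auto simp: nonempty_graph_def)

lemma nonempty_H: "nonempty_graph H"
proof -
  have "pair_bidirected_digraph H" "pair_pseudo_graph H"
    unfolding H_eq using edge new
    by (auto intro!: pair_bidirected_digraph_subdivide pair_pseudo_graph_subdivide)
  then have "pair_graph H"
    by (intro pair_graph.intro pair_digraph.intro)
      (auto simp: pair_bidirected_digraph_def pair_pseudo_graph_def)
  then show ?thesis
    by (auto simp: nonempty_graph_def H_eq)
qed

lemma deg_new: "deg H w = 2"
proof -
  have "out_arcs (with_proj H) w = {(w, u), (w, v)}"
    using ends new_arcs by (auto simp: out_arcs_def H_eq)
  then show ?thesis
    using ends by (simp add: out_degree_def)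
qed

text \<open>At \<open>u\<close> the arc to \<open>v\<close> is traded for the arc to
  \<open>w\<close>, so the count is unchanged.\<close>

lemma deg_end: "deg H u = deg G u"
proof -
  have "out_arcs (with_proj H) u = insert (u, w) (out_arcs (with_proj G) u - {(u, v)})"
    using ends by (auto simp: out_arcs_def H_eq)
  moreover have "(u, v) \<in> out_arcs (with_proj G) u" "(u, w) \<notin> out_arcs (with_proj G) u"
    using edge new_arcs by (auto simp: out_arcs_def)
  moreover have "finite (out_arcs (with_proj G) u)"
    by blast
  ultimately show ?thesis
    by (simp add: out_degree_def card_Suc_Diff1 del: card_Diff_insert)
qed

lemma deg_old:
  assumes "x \<in> pverts G"
  shows "deg H x = deg G x"
proof (cases "x = u \<or> x = v")
  case True
  then show ?thesis
    using deg_end edge_subdivision.deg_end[OF swap] by auto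
next
  case False
  then have "out_arcs (with_proj H) x = out_arcs (with_proj G) x"
    using assms new by (auto simp: out_arcs_def H_eq)
  then show ?thesis
    by (simp add: out_degree_def)
qed

lemma map_deg_old: "set p \<subseteq> pverts G \<Longrightarrow> map (deg H) p = map (deg G) p"
  by (auto simp: deg_old)

section \<open>The upper bound, by deleting \<open>w\<close> from a path\<close>

lemma remove_new:
  assumes p: "degree_monotone_path H p" and ne: "p \<noteq> [w]"
  shows "degree_monotone_path G (filter (\<lambda>x. x \<noteq> w) p)"
proof -
  let ?adj = "\<lambda>x y. (x, y) \<in> parcs G"
  let ?q = "filter (\<lambda>x. x \<noteq> w) p"
  have set_p: "set p \<subseteq> insert w (pverts G)" and dist: "distinct p" and "p \<noteq> []"
    and walk: "successively (\<lambda>x y. (x, y) \<in> parcs H) p"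
    using p by (auto simp: degree_monotone_path_iff H_eq)
  have old: "successively ?adj xs"
    if "successively (\<lambda>x y. (x, y) \<in> parcs H) xs" "w \<notin> set xs" for xs
    using that(1) by (rule successively_mono) (use that(2) in \<open>auto simp: H_eq\<close>)
  have "successively ?adj ?q"
  proof (cases "w \<in> set p")
    case True
    then obtain xs ys where eq: "p = xs @ w # ys"
      by (meson split_list)
    then have w: "w \<notin> set xs" "w \<notin> set ys"
      using dist by auto
    \<comment> \<open>The neighbours of \<open>w\<close> in \<open>H\<close> are \<open>u\<close>
      and \<open>v\<close> only. The path has distinct vertices, so it enters \<open>w\<close> from
      one of them and leaves to the other, and these two are adjacent in \<open>G\<close>.\<close>
    have join: "(last xs, hd ys) \<in> parcs G" if "xs \<noteq> []" "ys \<noteq> []"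
    proof -
      have "last xs \<in> {u, v}" "hd ys \<in> {u, v}"
        using walk that new_arcs ends w unfolding eq
        by (auto simp: successively_append_iff successively_Cons H_eq)
      moreover have "last xs \<noteq> hd ys"
        using dist that unfolding eq
        by (metis disjoint_iff distinct_append hd_in_set last_in_set list.set_intros(2))
      ultimately show ?thesis
        using edge edge' by auto
    qed
    have "successively ?adj xs" "successively ?adj ys"
      using walk w unfolding eq
      by (auto simp: successively_append_iff successively_Cons intro!: old)
    moreover have "?q = xs @ ys"
      using w by (auto simp: eq intro!: arg_cong2[where f = append] filter_True)
    ultimately show ?thesis
      using join by (auto simp: successively_append_iff)
  next
    case False
    then show ?thesis
      using old[OF walk] by (metis (mono_tags, lifting) filter_True)
  qed
  \<comment> \<open>A path must be non-empty, and \<open>[w]\<close> is the only path that deleting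
    \<open>w\<close> would empty.\<close>
  moreover have "?q \<noteq> []"
  proof
    assume "?q = []"
    then have "set p \<subseteq> {w}"
      by (auto simp: filter_empty_conv)
    with dist \<open>p \<noteq> []\<close> ne show False
      by (cases p; cases "tl p") auto
  qed
  moreover have "set ?q \<subseteq> pverts G"
    using set_p by auto
  moreover have "sorted_wrt (\<le>) (map (deg H) ?q) \<or> sorted_wrt (\<ge>) (map (deg H) ?q)"
    using p by (auto simp: degree_monotone_path_iff sorted_wrt_map intro: sorted_wrt_filter)
  ultimately show ?thesis
    using dist by (simp add: degree_monotone_path_iff map_deg_old)
qed

lemma mp_H_le: "mp H \<le> mp G + 1"
proof (rule mp_le[OF nonempty_H])
  fix p assume p: "degree_monotone_path H p"
  show "length p \<le> mp G + 1"
  proof (cases "p = [w]")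
    case False
    have "distinct p"
      using p by (simp add: degree_monotone_path_iff)
    \<comment> \<open>In a distinct list \<open>w\<close> occurs at most once, so the filter drops
      at most one vertex.\<close>
    then have "length p \<le> length (filter (\<lambda>x. x \<noteq> w) p) + 1"
      using distinct_remove1_removeAll[of p w] length_remove1[of w p]
      by (auto simp: removeAll_filter_not_eq eq_commute split: if_splits)
    also have "\<dots> \<le> mp G + 1"
      using length_le_mp[OF nonempty remove_new[OF p False]] by simp
    finally show ?thesis .
  qed simp
qed

section \<open>The lower bound, by cutting a path at the subdivided edge\<close>

lemma half_le_mp_H:
  assumes AB: "degree_monotone_path G (A @ B)" and "sorted_wrt (\<le>) (map (deg G) (A @ B))"
    and A: "A \<noteq> []" "last A = u" and B: "B \<noteq> []" "hd B = v"
  shows "length (A @ B) + 1 \<le> 2 * mp H"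
proof -
  have sets: "set A \<subseteq> pverts G" "set B \<subseteq> pverts G"
    and dist: "distinct A" "distinct B" "set A \<inter> set B = {}"
    and walk: "successively (\<lambda>x y. (x, y) \<in> parcs G) A" "successively (\<lambda>x y. (x, y) \<in> parcs G) B"
    using AB by (auto simp: degree_monotone_path_iff successively_append_iff)
  have deg: "sorted_wrt (\<le>) (map (deg G) A)" "sorted_wrt (\<le>) (map (deg G) B)"
    and le: "\<And>x y. x \<in> set A \<Longrightarrow> y \<in> set B \<Longrightarrow> deg G x \<le> deg G y"
    using assms(2) by (auto simp: sorted_wrt_append)
  have uv: "u \<in> set A" "v \<in> set B" "u \<notin> set B" "v \<notin> set A"
    using A B dist(3) last_in_set hd_in_set by blast+
  have wAB: "w \<notin> set A" "w \<notin> set B"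
    using sets new by auto
  \<comment> \<open>\<open>A\<close> misses \<open>v\<close> and \<open>B\<close> misses
    \<open>u\<close>, so neither piece uses a deleted arc.\<close>
  have walk_H: "successively (\<lambda>x y. (x, y) \<in> parcs H) A" "successively (\<lambda>x y. (x, y) \<in> parcs H) B"
    using uv by (auto simp: H_eq intro!: successively_mono[OF walk(1)] successively_mono[OF walk(2)])
  have base: "degree_monotone_path H A" "degree_monotone_path H B"
    using A B sets dist walk_H deg by (auto simp: degree_monotone_path_iff map_deg_old verts_H)
  have deg_H: "sorted_wrt (\<le>) (map (deg H) A)" "sorted_wrt (\<le>) (map (deg H) B)"
    using deg sets by (simp_all only: map_deg_old)
  have arcs_w: "(u, w) \<in> parcs H" "(w, v) \<in> parcs H"
    by (simp_all add: H_eq)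
  show ?thesis
  proof (cases "deg G v \<ge> 2")
    case True
    \<comment> \<open>\<open>v\<close> heads the ascending list \<open>B\<close>, so its degree is
      the least there, and \<open>w\<close> of degree 2 fits in front.\<close>
    have "deg G v \<le> deg G y" if "y \<in> set B" for y
      using deg(2) B that by (cases B) auto
    with True have "deg H w \<le> deg H y" if "y \<in> set B" for y
      using that sets deg_new deg_old[of y] by fastforce
    then have "degree_monotone_path H (w # B)"
      using base B wAB deg_H arcs_w
      by (auto simp: degree_monotone_path_iff successively_Cons verts_H)
    then show ?thesis
      using length_le_mp[OF nonempty_H] length_le_mp[OF nonempty_H base(1)] by fastforce
  next
    case False
    \<comment> \<open>Every vertex of \<open>A\<close> precedes \<open>v\<close> in the ascending
      path, so its degree is at most that of \<open>v\<close>, which is below 2.\<close>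
    have "deg H x \<le> deg H w" if "x \<in> set A" for x
      using le[OF that uv(2)] False deg_new deg_old[of x] sets that by auto
    then have "degree_monotone_path H (A @ [w])"
      using base A wAB deg_H arcs_w
      by (auto simp: degree_monotone_path_iff successively_append_iff sorted_wrt_append verts_H)
    then show ?thesis
      using length_le_mp[OF nonempty_H] length_le_mp[OF nonempty_H base(2)] by fastforce
  qed
qed

text \<open>A longest ascending path either crosses the edge, in one of the two directions, and is
  cut there, or avoids it and survives in \<open>H\<close>. In the latter case \<open>mp G\<close>
  is at most \<open>mp H\<close>, and positivity of \<open>mp H\<close> supplies the extra
  1.\<close>

lemma mp_G_le: "mp G + 1 \<le> 2 * mp H"
proof -
  obtain p where p: "degree_monotone_path G p" "length p = mp G"
    and asc: "sorted_wrt (\<le>) (map (deg G) p)"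
  proof -
    obtain p where p: "degree_monotone_path G p" "length p = mp G"
      using mp_attained[OF nonempty] .
    show thesis
    proof (cases "sorted_wrt (\<le>) (map (deg G) p)")
      case False
      then have "sorted_wrt (\<le>) (map (deg G) (rev p))"
        using p(1) by (auto simp: degree_monotone_path_iff rev_map[symmetric] sorted_wrt_rev)
      then show ?thesis
        using that[of "rev p"] p degree_monotone_path_rev[OF pair_graph] by simp
    qed (use that p in blast)
  qed
  show ?thesis
  proof (cases "\<exists>A B. p = A @ B \<and> A \<noteq> [] \<and> B \<noteq> [] \<and>
      (last A = u \<and> hd B = v \<or> last A = v \<and> hd B = u)")
    case True
    then show ?thesis
      using half_le_mp_H edge_subdivision.half_le_mp_H[OF swap] p asc by metis
  next
    case False
    \<comment> \<open>Cutting \<open>p\<close> after position \<open>i\<close> would contradict the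
      case assumption if this pair were a deleted arc.\<close>
    have "(p ! i, p ! Suc i) \<in> parcs H" if i: "Suc i < length p" for i
    proof -
      have "p = take (Suc i) p @ drop (Suc i) p"
        by simp
      moreover have "take (Suc i) p \<noteq> []" "drop (Suc i) p \<noteq> []"
        "last (take (Suc i) p) = p ! i" "hd (drop (Suc i) p) = p ! Suc i"
        using i by (auto simp: take_Suc_conv_app_nth hd_drop_conv_nth)
      ultimately have "(p ! i, p ! Suc i) \<notin> {(u, v), (v, u)}"
        using False by (metis (no_types, lifting) Pair_inject empty_iff insert_iff)
      moreover have "(p ! i, p ! Suc i) \<in> parcs G"
        using p(1) i by (auto simp: degree_monotone_path_iff successively_conv_nth)
      ultimately show ?thesis
        by (auto simp: H_eq)
    qed
    then have "degree_monotone_path H p"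
      using p(1) by (auto simp: degree_monotone_path_iff successively_conv_nth map_deg_old verts_H)
    then have "mp G \<le> mp H"
      using length_le_mp[OF nonempty_H] p(2) by metis
    then show ?thesis
      using mp_pos[OF nonempty_H] by simp
  qed
qed

lemma ceiling_le_mp_H: "\<lceil>(real (mp G) + 1) / 2\<rceil> \<le> int (mp H)"
  using mp_G_le by (simp add: ceiling_le_iff)

end

lemma edge_subdivisionI:
  assumes "nonempty_graph G" "(u, v) \<in> parcs G" "w \<notin> pverts G"
  shows "edge_subdivision G u v w (subdivide G (u, v) w)"
  using assms by (simp add: nonempty_graph_def edge_subdivision_def edge_subdivision_axioms_def)

section \<open>Complete graphs and sharpness of both bounds\<close>

definition complete_graph :: "nat \<Rightarrow> nat pair_pre_digraph" where
  "complete_graph n = \<lparr>pverts = {..<n}, parcs = {(x, y). x < n \<and> y < n \<and> x \<noteq> y}\<rparr>"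

lemma pverts_complete_graph [simp]: "pverts (complete_graph n) = {..<n}"
  and parcs_complete_graph [simp]: "parcs (complete_graph n) = {(x, y). x < n \<and> y < n \<and> x \<noteq> y}"
  by (simp_all add: complete_graph_def)

lemma nonempty_complete_graph:
  assumes "n > 0"
  shows "nonempty_graph (complete_graph n)"
proof -
  have "finite {(x, y). x < n \<and> y < n \<and> x \<noteq> y}"
    by (rule finite_subset[of _ "{..<n} \<times> {..<n}"]) auto
  then have "pair_graph (complete_graph n)"
    by unfold_locales (auto simp: symmetric_def sym_def)
  then show ?thesis
    using assms by (auto simp: nonempty_graph_def)
qed

lemma deg_complete_graph:
  assumes "x < n"
  shows "deg (complete_graph n) x = n - 1"
proof -
  have "out_arcs (with_proj (complete_graph n)) x = Pair x ` ({..<n} - {x})"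
    using assms by (auto simp: out_arcs_def)
  then show ?thesis
    using assms by (simp add: out_degree_def card_image inj_on_def)
qed

lemma mp_complete_graph:
  assumes "n > 0"
  shows "mp (complete_graph n) = n"
proof (rule antisym)
  show "mp (complete_graph n) \<le> n"
    using mp_le_card[OF nonempty_complete_graph[OF assms]] by simp
  have "degree_monotone_path (complete_graph n) [0..<n]"
    using assms by (auto simp: degree_monotone_path_iff successively_conv_nth sorted_wrt_map
        deg_complete_graph sorted_wrt_iff_nth_less)
  then show "n \<le> mp (complete_graph n)"
    using length_le_mp[OF nonempty_complete_graph[OF assms]] by fastforce
qed

text \<open>The subdivided graph is the path 0, 2, 1 with degrees 1, 2, 1, which is not monotone as
  a whole.\<close>

lemma mp_subdivided_edge_le: "mp (subdivide (complete_graph 2) (0, 1) 2) \<le> 2"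
proof -
  let ?H = "subdivide (complete_graph 2) (0, 1) 2"
  interpret edge_subdivision "complete_graph 2" 0 1 2 ?H
    by (rule edge_subdivisionI) (simp_all add: nonempty_complete_graph)
  have deg: "deg ?H 2 = 2" "deg ?H 0 = 1" "deg ?H 1 = 1"
    using deg_new deg_old[of 0] deg_old[of 1] by (simp_all add: deg_complete_graph)
  show ?thesis
  proof (rule mp_le[OF nonempty_H])
    fix p assume p: "degree_monotone_path ?H p"
    show "length p \<le> 2"
    proof (rule ccontr)
      assume "\<not> length p \<le> 2"
      then have "3 \<le> length p"
        by simp
      then obtain x y z q where eq: "p = x # y # z # q"
        by (auto simp: numeral_3_eq_3 Suc_le_length_iff)
      have arcs: "parcs ?H = {(0, 2), (2, 0), (1, 2), (2, 1)}"
        by (auto simp: less_2_cases_iff)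
      have "(x, y) \<in> parcs ?H" "(y, z) \<in> parcs ?H" "x \<noteq> z"
        using p eq by (auto simp only: degree_monotone_path_iff successively.simps distinct.simps
            list.set insert_iff)
      \<comment> \<open>Every arc has 2 as one end. If \<open>y\<close> were 0 or 1, both
        \<open>x\<close> and \<open>z\<close> would be 2, against distinctness.\<close>
      then have "y = 2 \<and> x \<in> {0, 1} \<and> z \<in> {0, 1}"
        unfolding arcs by auto
      moreover have "sorted_wrt (\<le>) (map (deg ?H) p) \<or> sorted_wrt (\<ge>) (map (deg ?H) p)"
        using p by (simp only: degree_monotone_path_iff)
      ultimately show False
        using deg unfolding eq by auto
    qed
  qed
qed

text \<open>The subdivided triangle is a 4-cycle. All its degrees are 2, so any Hamiltonian path is
  degree monotone.\<close>

lemma le_mp_subdivided_triangle: "4 \<le> mp (subdivide (complete_graph 3) (0, 1) 3)"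
proof -
  let ?H = "subdivide (complete_graph 3) (0, 1) 3"
  interpret edge_subdivision "complete_graph 3" 0 1 3 ?H
    by (rule edge_subdivisionI) (simp_all add: nonempty_complete_graph)
  have "deg ?H x = 2" if "x < 4" for x
    using that deg_new deg_old[of x] by (cases "x = 3") (auto simp: deg_complete_graph)
  then have "degree_monotone_path ?H [0, 3, 1, 2]"
    by (auto simp: degree_monotone_path_iff)
  then show ?thesis
    using length_le_mp[OF nonempty_H] by fastforce
qed

theorem theorem2p2:
  shows "(\<forall>(G :: 'a pair_pre_digraph) u v w.
            nonempty_graph G \<and> (u, v) \<in> parcs G \<and> w \<notin> pverts G \<longrightarrow>
              \<lceil>(real (mp G) + 1) / 2\<rceil> \<le> int (mp (subdivide G (u, v) w)) \<and>
              mp (subdivide G (u, v) w) \<le> mp G + 1) \<and>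
         (\<exists>(G :: nat pair_pre_digraph) u v w.
            nonempty_graph G \<and> (u, v) \<in> parcs G \<and> w \<notin> pverts G \<and>
              \<lceil>(real (mp G) + 1) / 2\<rceil> = int (mp (subdivide G (u, v) w))) \<and>
         (\<exists>(G :: nat pair_pre_digraph) u v w.
            nonempty_graph G \<and> (u, v) \<in> parcs G \<and> w \<notin> pverts G \<and>
              mp (subdivide G (u, v) w) = mp G + 1)"
proof (intro conjI allI impI)
  fix G :: "'a pair_pre_digraph" and u v w
  assume "nonempty_graph G \<and> (u, v) \<in> parcs G \<and> w \<notin> pverts G"
  then interpret edge_subdivision G u v w "subdivide G (u, v) w"
    by (intro edge_subdivisionI) auto
  show "\<lceil>(real (mp G) + 1) / 2\<rceil> \<le> int (mp (subdivide G (u, v) w))"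
    by (rule ceiling_le_mp_H)
  show "mp (subdivide G (u, v) w) \<le> mp G + 1"
    by (rule mp_H_le)
next
  let ?G = "complete_graph 2"
  have G: "nonempty_graph ?G" "(0, 1) \<in> parcs ?G" "2 \<notin> pverts ?G"
    by (simp_all add: nonempty_complete_graph)
  \<comment> \<open>Here \<open>mp ?G\<close> is 2 and the ceiling of 3/2 is 2. The general lower
    bound gives one inequality, the explicit estimate the other.\<close>
  moreover have "\<lceil>(real (mp ?G) + 1) / 2\<rceil> = int (mp (subdivide ?G (0, 1) 2))"
    using edge_subdivision.mp_G_le[OF edge_subdivisionI[OF G]] mp_subdivided_edge_le
    by (simp add: mp_complete_graph ceiling_eq_iff)
  ultimately show "\<exists>(G :: nat pair_pre_digraph) u v w.
      nonempty_graph G \<and> (u, v) \<in> parcs G \<and> w \<notin> pverts G \<and>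
        \<lceil>(real (mp G) + 1) / 2\<rceil> = int (mp (subdivide G (u, v) w))"
    by blast
next
  let ?G = "complete_graph 3"
  have G: "nonempty_graph ?G" "(0, 1) \<in> parcs ?G" "3 \<notin> pverts ?G"
    by (simp_all add: nonempty_complete_graph)
  moreover have "mp (subdivide ?G (0, 1) 3) = mp ?G + 1"
    using edge_subdivision.mp_H_le[OF edge_subdivisionI[OF G]] le_mp_subdivided_triangle
    by (simp add: mp_complete_graph)
  ultimately show "\<exists>(G :: nat pair_pre_digraph) u v w.
      nonempty_graph G \<and> (u, v) \<in> parcs G \<and> w \<notin> pverts G \<and>
        mp (subdivide G (u, v) w) = mp G + 1"
    by blast
qed

end
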